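(* Let $O\subseteq[n]$ and $I=[n]\setminus O$. The lattice $\mathcal R_{n,O}$ is generated by chain types in $\mathcal T_{n,O}$, of the form $$1-p_{\{j\}}+p_{I\cup\{j\}},\qquad p_{\{i\}}-p_{\{i,j\}}+p_{I\cup\{j\}},\qquad j\in O,\ i\in I.$$
   Context: Notation. $[n]=\{1,\dots,n\}$; $\theta=\theta_n\in\{0,1\}^n$ is the zero string. $\mathcal F_n=\{f:\{0,1\}^n\to\{0,1\} : f(\theta)=1\}$ is a Boolean algebra for the pointwise order, with $\vee,\wedge$ the pointwise maximum/minimum; $p_n$ is the indicator function of $\{\theta\}$, $1_n$ (also written $1$) is the constant function $1$, and the complement is $f^*=1-f+p_n$. For $T\subseteq[n]$, $p_T(s)=\prod_{i\in T}(1-s_i)$ (so $p_\emptyset=1_n$, $p_{[n]}=p_n$). For $f\in\mathcal F_m$, $g\in\mathcal F_n$, $(f\otimes g)(s^1s^2)=f(s^1)g(s^2)$, where $s^1\in\{0,1\}^m$, $s^2\in\{0,1\}^n$ and $s^1s^2$ is the concatenation. A permutation $\sigma$ of $[n]$ acts on strings by $\sigma(s)=s_{\sigma^{-1}(1)}\dots s_{\sigma^{-1}(n)}$, and $f\circ\sigma$ is the composition. Inputs/outputs. Let $e^i\in\{0,1\}^n$ be the string with $e^i_j=\delta_{i,j}$. For $f\in\mathcal F_n$: $I_f=\{i: f(e^i)=0\}$, $O_f=\{j: f(e^j)=1\}$. Type functions. The sets $\mathcal T_n\subseteq\mathcal F_n$ ($n\ge1$) of type functions form the smallest family with $1_1\in\mathcal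 T_1$ that is closed under $f\mapsto f^*$, $f\mapsto f\circ\sigma$ (all permutations), and $(f,g)\mapsto f\otimes g$. $\mathcal T_{n,O}=\{f\in\mathcal T_n: O_f=O\}$. A type function $f\in\mathcal T_n$ is a chain type if there are sets $S_0\subsetneq S_1\subsetneq\dots\subsetneq S_N\subseteq[n]$ with $N$ even such that $f=\sum_{i=0}^N(-1)^ip_{S_i}$. $\mathcal R_{n,O}$ is the sublattice of $\mathcal F_n$ (with operations $\vee$, $\wedge$) generated by $\mathcal T_{n,O}$; it is contained in the interval $[p_I,p_O^*]$ of $\mathcal F_n$. In the extreme cases $O=\emptyset$ and $O=[n]$ this interval, and hence $\mathcal R_{n,O}$, consists of a single function, $p_n$ and $1_n$ respectively. (If $I=\{i\}$, the second expression in the claim reduces to $p_{\{i\}}=p_I$; if $I=\emptyset$, the first reduces to $1_n$.) *)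

theory Defs
  imports Main "HOL-Library.FuncSet" "HOL-Combinatorics.Permutations"
begin

text \<open>
  Strings in \<open>{0,1}\<^sup>n\<close> are Boolean lists of length \<open>n\<close>; list indices start at 0, so the
  letter \<open>s\<^sub>i\<close> (\<open>1 \<le> i \<le> n\<close>) is \<open>s ! (i - 1)\<close>, read as a number by \<open>of_bool\<close>.
\<close>

definition strings :: "nat \<Rightarrow> bool list set" where
  "strings n = {s. length s = n}"

definition zero_string :: "nat \<Rightarrow> bool list" where
  "zero_string n = replicate n False"

definition unit_string :: "nat \<Rightarrow> nat \<Rightarrow> bool list" where
  "unit_string n i = map (\<lambda>j. j = i) [1..<n + 1]"

text \<open>
  A function on \<open>{0,1}\<^sup>n\<close> is extensional (\<open>undefined\<close> off \<open>strings n\<close>), so that equality of HOL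
  functions is equality on \<open>{0,1}\<^sup>n\<close>. Values are integers, so that the alternating sums below
  are computed without truncation.
\<close>

type_synonym bfun = "bool list \<Rightarrow> int"

definition F :: "nat \<Rightarrow> bfun set" where
  "F n = {f \<in> strings n \<rightarrow>\<^sub>E {0, 1}. f (zero_string n) = 1}"

definition join :: "nat \<Rightarrow> bfun \<Rightarrow> bfun \<Rightarrow> bfun" where
  "join n f g = (\<lambda>s\<in>strings n. max (f s) (g s))"

definition meet :: "nat \<Rightarrow> bfun \<Rightarrow> bfun \<Rightarrow> bfun" where
  "meet n f g = (\<lambda>s\<in>strings n. min (f s) (g s))"

definition one :: "nat \<Rightarrow> bfun" where
  "one n = (\<lambda>s\<in>strings n. 1)"

definition p :: "nat \<Rightarrow> nat set \<Rightarrow> bfun" where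
  "p n T = (\<lambda>s\<in>strings n. \<Prod>i\<in>T. 1 - of_bool (s ! (i - 1)))"

definition p_zero :: "nat \<Rightarrow> bfun" where
  "p_zero n = (\<lambda>s\<in>strings n. of_bool (s = zero_string n))"

definition compl :: "nat \<Rightarrow> bfun \<Rightarrow> bfun" where
  "compl n f = (\<lambda>s\<in>strings n. 1 - f s + p_zero n s)"

definition tensor :: "nat \<Rightarrow> nat \<Rightarrow> bfun \<Rightarrow> bfun \<Rightarrow> bfun" where
  "tensor m n f g = (\<lambda>s\<in>strings (m + n). f (take m s) * g (drop m s))"

definition act :: "nat \<Rightarrow> (nat \<Rightarrow> nat) \<Rightarrow> bool list \<Rightarrow> bool list" where
  "act n \<sigma> s = map (\<lambda>i. s ! (inv \<sigma> i - 1)) [1..<n + 1]"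

definition perm_comp :: "nat \<Rightarrow> bfun \<Rightarrow> (nat \<Rightarrow> nat) \<Rightarrow> bfun" where
  "perm_comp n f \<sigma> = (\<lambda>s\<in>strings n. f (act n \<sigma> s))"

definition outputs :: "nat \<Rightarrow> bfun \<Rightarrow> nat set" where
  "outputs n f = {j \<in> {1..n}. f (unit_string n j) = 1}"

inductive is_type :: "nat \<Rightarrow> bfun \<Rightarrow> bool" where
  one: "is_type 1 (one 1)"
| compl: "is_type n f \<Longrightarrow> is_type n (compl n f)"
| perm: "is_type n f \<Longrightarrow> \<sigma> permutes {1..n} \<Longrightarrow> is_type n (perm_comp n f \<sigma>)"
| tensor: "is_type m f \<Longrightarrow> is_type n g \<Longrightarrow> is_type (m + n) (tensor m n f g)"

definition types :: "nat \<Rightarrow> bfun set" where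
  "types n = {f. is_type n f}"

definition types_out :: "nat \<Rightarrow> nat set \<Rightarrow> bfun set" where
  "types_out n Out = {f \<in> types n. outputs n f = Out}"

definition chain_type :: "nat \<Rightarrow> bfun \<Rightarrow> bool" where
  "chain_type n f \<longleftrightarrow> f \<in> types n \<and>
     (\<exists>(N::nat) S. even N \<and> (\<forall>i<N. S i \<subset> S (Suc i)) \<and> S N \<subseteq> {1..n} \<and>
        f = (\<lambda>s\<in>strings n. \<Sum>i\<le>N. (- 1) ^ i * p n (S i) s))"

text \<open>
  For \<open>G \<subseteq> F n\<close>, the smallest subset of \<open>F n\<close> that contains \<open>G\<close> and is closed under the binary
  operations; the bounds of \<open>F n\<close> are not added, and no generators give the empty set.
\<close>

inductive_set sublattice :: "nat \<Rightarrow> bfun set \<Rightarrow> bfun set" for n G where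
  gen: "f \<in> G \<Longrightarrow> f \<in> sublattice n G"
| join: "f \<in> sublattice n G \<Longrightarrow> g \<in> sublattice n G \<Longrightarrow> join n f g \<in> sublattice n G"
| meet: "f \<in> sublattice n G \<Longrightarrow> g \<in> sublattice n G \<Longrightarrow> meet n f g \<in> sublattice n G"

definition R :: "nat \<Rightarrow> nat set \<Rightarrow> bfun set" where
  "R n Out = sublattice n (types_out n Out)"

definition gen_out :: "nat \<Rightarrow> nat set \<Rightarrow> nat \<Rightarrow> bfun" where
  "gen_out n In j = (\<lambda>s\<in>strings n. 1 - p n {j} s + p n (In \<union> {j}) s)"

definition gen_in_out :: "nat \<Rightarrow> nat set \<Rightarrow> nat \<Rightarrow> nat \<Rightarrow> bfun" where
  "gen_in_out n In i j = (\<lambda>s\<in>strings n. p n {i} s - p n {i, j} s + p n (In \<union> {j}) s)"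

definition generators :: "nat \<Rightarrow> nat set \<Rightarrow> nat set \<Rightarrow> bfun set" where
  "generators n In Out =
     {gen_out n In j |j. j \<in> Out} \<union> {gen_in_out n In i j |i j. i \<in> In \<and> j \<in> Out}"

lemma act_in_strings: "s \<in> strings n \<Longrightarrow> act n \<sigma> s \<in> strings n"
  by (simp add: strings_def act_def)

lemma act_zero_string:
  assumes "\<sigma> permutes {1..n}"
  shows "act n \<sigma> (zero_string n) = zero_string n"
proof (rule nth_equalityI)
  fix i assume "i < length (act n \<sigma> (zero_string n))"
  hence i: "i < n" by (simp add: act_def del: upt_Suc)
  have "inv \<sigma> (Suc i) \<in> {1..n}" using permutes_in_image[OF permutes_inv[OF assms], of "Suc i"] i by auto
  then have "inv \<sigma> (Suc i) - 1 < n" by auto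
  then show "act n \<sigma> (zero_string n) ! i = zero_string n ! i" using i
    by (simp add: act_def zero_string_def nth_replicate del: upt_Suc)
qed (simp add: act_def zero_string_def)

lemma zero_string_in_strings: "zero_string n \<in> strings n"
  by (simp add: zero_string_def strings_def)

lemma take_drop_in_strings: "s \<in> strings (m+n) \<Longrightarrow> take m s \<in> strings m \<and> drop m s \<in> strings n"
  by (simp add: strings_def)

lemma take_drop_zero_string: "take m (zero_string (m+n)) = zero_string m" "drop m (zero_string (m+n)) = zero_string n"
  by (simp_all add: zero_string_def)

lemma F_intro: "\<lbrakk>\<And>s. s \<in> strings n \<Longrightarrow> h s = 0 \<or> h s = 1; h (zero_string n) = 1\<rbrakk> \<Longrightarrow> (\<lambda>s\<in>strings n. h s) \<in> F n"
  using zero_string_in_strings by (auto simp: F_def)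

lemma F_dest: "f \<in> F n \<Longrightarrow> s \<in> strings n \<Longrightarrow> f s = 0 \<or> f s = 1" "f \<in> F n \<Longrightarrow> f (zero_string n) = 1"
  by (auto simp: F_def PiE_iff)

lemma is_type_in_F: "is_type n f \<Longrightarrow> f \<in> F n"
proof (induction rule: is_type.induct)
  case one show ?case unfolding one_def by (rule F_intro) auto
next case (compl n f) show ?case unfolding compl_def
    by (rule F_intro) (use F_dest[OF compl.IH] zero_string_in_strings in \<open>auto simp: p_zero_def split: if_splits\<close>)
next case (perm n f \<sigma>) show ?case unfolding perm_comp_def 
   by (rule F_intro) (use F_dest[OF perm.IH] act_in_strings act_zero_string perm in auto)
next case (tensor m f n g) show ?case unfolding tensor_def
   by (rule F_intro) (use F_dest[OF tensor.IH(1)] F_dest[OF tensor.IH(2)] take_drop_in_strings take_drop_zero_string in \<open>force+\<close>)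
qed

lemma p_full: "p n {1..n} = p_zero n"
proof (rule ext)
  fix s
  have "(\<Prod>i\<in>{1..n}. 1 - of_bool (s ! (i - 1))) = (of_bool (s = zero_string n) :: int)" if s: "length s = n"
  proof (cases "s = zero_string n")
    case True then show ?thesis by (auto simp: zero_string_def intro!: prod.neutral)
  next
    case False
    then obtain i where "i < n" "s ! i" using s by (auto simp: zero_string_def list_eq_iff_nth_eq)
    then show ?thesis using False by (auto intro!: prod_zero bexI[of _ "Suc i"])
  qed
  then show "p n {1..n} s = p_zero n s" by (simp add: p_def p_zero_def strings_def)
qed

end

theory Submission
  imports Defs
begin

text \<open>
  Identify a string with the set \<open>A\<close> of its ones. By induction, a type function is monotone for the
  order \<open>A \<le> B \<longleftrightarrow> A \<inter> O \<subseteq> B \<and> B \<inter> I \<subseteq> A\<close>. On the \<open>A\<close> that meet \<open>I\<close>, the generators are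
  the conditions \<open>j \<in> A\<close> and \<open>j \<in> A \<and> i \<notin> A\<close>, and elsewhere they equal 1. Their meets are
  therefore the (indicators of) principal up-sets, and a monotone function is the join of the
  principal up-sets below it. Conversely,
  \<open>1 - p\<^bsub>{j}\<^esub> + p\<^bsub>I \<union> {j}\<^esub> = (p\<^sub>1 \<otimes> 1)\<^sup>* \<otimes> 1\<close> and
  \<open>p\<^bsub>{i}\<^esub> - p\<^bsub>{i,j}\<^esub> + p\<^bsub>I \<union> {j}\<^esub> = p\<^sub>1 \<otimes> (p\<^sub>1 \<otimes> 1)\<^sup>* \<otimes> 1\<close> up to a permutation.
\<close>

section \<open>Strings as sets of ones\<close>

definition ones :: "bool list \<Rightarrow> nat set" where
  "ones s = {k. 1 \<le> k \<and> k \<le> length s \<and> s ! (k - 1)}"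

text \<open>Inverse of \<open>ones\<close> on subsets of \<open>{1..n}\<close>; elements of
  \<open>A\<close> outside that range are ignored.\<close>

definition string_of :: "nat \<Rightarrow> nat set \<Rightarrow> bool list" where
  "string_of n A = map (\<lambda>k. k \<in> A) [1..<n + 1]"

text \<open>Common normal form of all functions below: \<open>join\<close> and \<open>meet\<close>
  become disjunction and conjunction of predicates, and \<open>p n T\<close> becomes disjointness
  from \<open>T\<close>.\<close>

definition chi :: "nat \<Rightarrow> (nat set \<Rightarrow> bool) \<Rightarrow> bfun" where
  "chi n P = (\<lambda>s\<in>strings n. of_bool (P (ones s)))"

lemma ones_subset: "s \<in> strings n \<Longrightarrow> ones s \<subseteq> {1..n}"
  by (auto simp: ones_def strings_def)

lemma string_of_in_strings [simp]: "string_of n A \<in> strings n"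
  by (simp add: string_of_def strings_def)

lemma ones_string_of: "ones (string_of n A) = A \<inter> {1..n}"
  by (auto simp: ones_def string_of_def simp del: upt_Suc)

lemma string_of_ones: 
  assumes "s \<in> strings n"
  shows "string_of n (ones s) = s"
  using assms by (auto intro!: nth_equalityI simp: ones_def string_of_def strings_def simp del: upt_Suc)

lemma ones_inject: "s \<in> strings n \<Longrightarrow> t \<in> strings n \<Longrightarrow> ones s = ones t \<longleftrightarrow> s = t"
  by (metis string_of_ones)

lemma unit_string_eq: "unit_string n k = string_of n {k}"
  by (simp add: unit_string_def string_of_def)

lemma unit_string_in_strings [simp]: "unit_string n k \<in> strings n"
  by (simp add: unit_string_eq)

lemma ones_unit_string: "k \<in> {1..n} \<Longrightarrow> ones (unit_string n k) = {k}"
  by (auto simp: unit_string_eq ones_string_of)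

lemma ones_zero_string [simp]: "ones (zero_string n) = {}"
  by (auto simp: ones_def zero_string_def nth_replicate)

lemma ones_empty_iff: "s \<in> strings n \<Longrightarrow> ones s = {} \<longleftrightarrow> s = zero_string n"
  using ones_inject[OF _ zero_string_in_strings] by simp

lemma p_zero_eq: "s \<in> strings n \<Longrightarrow> p_zero n s = of_bool (ones s = {})"
  by (simp add: p_zero_def ones_empty_iff)

lemma take_in_strings: "s \<in> strings (m + n) \<Longrightarrow> take m s \<in> strings m"
  and drop_in_strings: "s \<in> strings (m + n) \<Longrightarrow> drop m s \<in> strings n"
  by (simp_all add: strings_def)

text \<open>Letter \<open>k\<close> of the permuted string is the old letter
  \<open>inv \<sigma> k\<close>, so a one at position \<open>i\<close> moves to position
  \<open>\<sigma> i\<close>.\<close>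

lemma ones_act:
  assumes "\<sigma> permutes {1..n}" "s \<in> strings n"
  shows "ones (act n \<sigma> s) = \<sigma> ` ones s"
proof -
  have "k \<in> ones (act n \<sigma> s) \<longleftrightarrow> inv \<sigma> k \<in> ones s" if k: "k \<in> {1..n}" for k
  proof -
    have "inv \<sigma> k \<in> {1..n}" using permutes_in_image[OF permutes_inv[OF assms(1)]] k by blast
    moreover have "act n \<sigma> s ! (k - 1) = s ! (inv \<sigma> k - 1)"
      using k nth_map_upt[of "k - 1" "n + 1" 1 "\<lambda>i. s ! (inv \<sigma> i - 1)"]
      by (auto simp: act_def simp del: upt_Suc)
    moreover have "length (act n \<sigma> s) = n" "length s = n"
      using assms(2) by (auto simp: act_def strings_def)
    ultimately show ?thesis using k by (auto simp: ones_def)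
  qed
  moreover have "ones (act n \<sigma> s) \<subseteq> {1..n}"
    by (rule ones_subset[OF act_in_strings[OF assms(2)]])
  ultimately have "ones (act n \<sigma> s) = {k \<in> {1..n}. inv \<sigma> k \<in> ones s}"
    by blast
  also have "\<dots> = inv \<sigma> -` ones s"
    using ones_subset[OF assms(2)] permutes_in_image[OF permutes_inv[OF assms(1)]] by blast
  also have "\<dots> = \<sigma> ` ones s"
    using bij_vimage_eq_inv_image[OF permutes_bij[OF permutes_inv[OF assms(1)]]]
    by (simp add: permutes_inv_inv[OF assms(1)])
  finally show ?thesis .
qed

lemma ones_append: "ones (s @ t) = ones s \<union> (\<lambda>k. k + length s) ` ones t"
proof (intro set_eqI)
  fix k
  have "k \<in> (\<lambda>k. k + length s) ` ones t \<longleftrightarrow> length s < k \<and> k - length s \<in> ones t"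
    by (auto simp: ones_def image_iff intro!: exI[of _ "k - length s"])
  then show "k \<in> ones (s @ t) \<longleftrightarrow> k \<in> ones s \<union> (\<lambda>k. k + length s) ` ones t"
    by (auto simp: ones_def nth_append)
qed

lemma ones_take_drop:
  assumes "s \<in> strings (m + n)"
  shows "ones s = ones (take m s) \<union> (\<lambda>k. k + m) ` ones (drop m s)"
  using ones_append[of "take m s" "drop m s"] assms by (simp add: strings_def)

lemma ones_take: "s \<in> strings (m + n) \<Longrightarrow> ones (take m s) = ones s \<inter> {1..m}"
  by (auto simp: ones_def strings_def)

lemma ones_drop: "s \<in> strings (m + n) \<Longrightarrow> ones (drop m s) = {k. 1 \<le> k \<and> k + m \<in> ones s}"
  by (auto simp: ones_def strings_def add.commute)

lemma chi_cong:
  assumes "\<And>A. A \<subseteq> {1..n} \<Longrightarrow> P A \<longleftrightarrow> Q A"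
  shows "chi n P = chi n Q"
  unfolding chi_def by (rule restrict_ext) (simp only: assms ones_subset)

lemma F_eq_chi:
  assumes "f \<in> F n"
  shows "f = chi n (\<lambda>A. f (string_of n A) = 1)"
proof
  fix s
  show "f s = chi n (\<lambda>A. f (string_of n A) = 1) s"
    using assms F_dest(1)[OF assms, of s]
    by (cases "s \<in> strings n") (auto simp: chi_def string_of_ones F_def PiE_iff extensional_def)
qed

lemma p_eq:
  assumes "T \<subseteq> {1..n}"
  shows "p n T = chi n (\<lambda>A. A \<inter> T = {})"
proof -
  have "(\<Prod>i\<in>T. 1 - of_bool (s ! (i - 1))) = (of_bool (ones s \<inter> T = {}) :: int)" if "s \<in> strings n" for s
  proof -
    \<comment> \<open>Here \<open>T \<subseteq> {1..n}\<close> matters: for \<open>i = 0\<close> the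
      truncated \<open>i - 1\<close> would read the first letter.\<close>
    have iff: "s ! (i - 1) \<longleftrightarrow> i \<in> ones s" if "i \<in> T" for i
      using that assms \<open>s \<in> strings n\<close> by (auto simp: ones_def strings_def)
    have "(\<Prod>i\<in>T. 1 - of_bool (s ! (i - 1))) = (\<Prod>i\<in>T. of_bool (i \<notin> ones s) :: int)"
      by (rule prod.cong) (use iff in auto)
    also have "\<dots> = of_bool (\<forall>i\<in>T. i \<notin> ones s)"
      using finite_subset[OF assms] by (induction T rule: infinite_finite_induct) auto
    finally show ?thesis by (simp add: disjoint_iff) blast
  qed
  then show ?thesis by (auto simp: p_def chi_def fun_eq_iff restrict_def)
qed

subsection \<open>Monotonicity of type functions\<close>

lemma outputs_subset: "outputs n f \<subseteq> {1..n}"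
  by (auto simp: outputs_def)

text \<open>The correction \<open>p_zero\<close> vanishes at unit strings, so there the complement
  is just \<open>1 - f\<close>.\<close>

lemma outputs_compl:
  assumes "f \<in> F n"
  shows "outputs n (compl n f) = {1..n} - outputs n f"
proof -
  have "compl n f (unit_string n k) = 1 \<longleftrightarrow> f (unit_string n k) \<noteq> 1" if "k \<in> {1..n}" for k
    using that F_dest(1)[OF assms unit_string_in_strings]
    by (auto simp: compl_def p_zero_eq ones_unit_string)
  then show ?thesis by (auto simp: outputs_def)
qed

lemma outputs_perm_comp:
  assumes "\<sigma> permutes {1..n}"
  shows "\<sigma> ` outputs n (perm_comp n f \<sigma>) = outputs n f"
proof -
  have "act n \<sigma> (unit_string n k) = unit_string n (\<sigma> k)" if "k \<in> {1..n}" for k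
  proof -
    have "\<sigma> k \<in> {1..n}" using that permutes_in_image[OF assms] by simp
    then have "ones (act n \<sigma> (unit_string n k)) = ones (unit_string n (\<sigma> k))"
      using that by (simp add: ones_act[OF assms] ones_unit_string del: atLeastAtMost_iff)
    then show ?thesis
      using ones_inject[OF act_in_strings[OF unit_string_in_strings] unit_string_in_strings] by blast
  qed
  then have val: "perm_comp n f \<sigma> (unit_string n k) = f (unit_string n (\<sigma> k))" if "k \<in> {1..n}" for k
    using that by (simp add: perm_comp_def)
  have "outputs n (perm_comp n f \<sigma>) = \<sigma> -` outputs n f"
  proof (rule set_eqI)
    fix k
    have "k \<in> outputs n (perm_comp n f \<sigma>) \<longleftrightarrow> k \<in> {1..n} \<and> perm_comp n f \<sigma> (unit_string n k) = 1"
      by (simp only: outputs_def mem_Collect_eq)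
    also have "\<dots> \<longleftrightarrow> \<sigma> k \<in> {1..n} \<and> f (unit_string n (\<sigma> k)) = 1"
      using val[of k] by (simp only: permutes_in_image[OF assms] cong: conj_cong)
    also have "\<dots> \<longleftrightarrow> k \<in> \<sigma> -` outputs n f"
      by (simp only: outputs_def mem_Collect_eq vimage_eq)
    finally show "k \<in> outputs n (perm_comp n f \<sigma>) \<longleftrightarrow> k \<in> \<sigma> -` outputs n f" .
  qed
  then show ?thesis by (simp only: surj_image_vimage_eq[OF permutes_surj[OF assms]])
qed

text \<open>Cutting a unit string leaves a unit string in one block and the zero string in the
  other, where every function in \<open>F\<close> has value 1.\<close>

lemma outputs_tensor:
  assumes "f \<in> F m" "g \<in> F n"
  shows "outputs (m + n) (tensor m n f g) = outputs m f \<union> (\<lambda>k. k + m) ` outputs n g"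
proof -
  have left: "tensor m n f g (unit_string (m + n) k) = f (unit_string m k)" if "k \<in> {1..m}" for k
  proof -
    have "take m (unit_string (m + n) k) = unit_string m k"
      using that by (subst ones_inject[symmetric, of _ m])
        (auto simp: ones_take[where n = n] ones_unit_string take_in_strings[where n = n] drop_in_strings[where m = m])
    moreover have "drop m (unit_string (m + n) k) = zero_string n"
      using that by (subst ones_inject[symmetric, of _ n])
        (auto simp: ones_drop[where n = n] ones_unit_string take_in_strings[where n = n] drop_in_strings[where m = m] zero_string_in_strings)
    ultimately show ?thesis using assms by (simp add: tensor_def F_dest)
  qed
  have right: "tensor m n f g (unit_string (m + n) (k + m)) = g (unit_string n k)" if "k \<in> {1..n}" for k
  proof -
    have "take m (unit_string (m + n) (k + m)) = zero_string m"
      using that by (subst ones_inject[symmetric, of _ m])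
        (auto simp: ones_take[where n = n] ones_unit_string take_in_strings[where n = n] drop_in_strings[where m = m] zero_string_in_strings)
    moreover have "drop m (unit_string (m + n) (k + m)) = unit_string n k"
      using that by (subst ones_inject[symmetric, of _ n])
        (auto simp: ones_drop[where n = n] ones_unit_string take_in_strings[where n = n] drop_in_strings[where m = m])
    ultimately show ?thesis using assms by (simp add: tensor_def F_dest)
  qed
  show ?thesis
  proof (intro set_eqI)
    fix k
    consider "k \<le> m" | l where "k = l + m" "l \<ge> 1"
      using that(1) that(2)[of "k - m"] by (cases "k \<le> m") auto
    then show "k \<in> outputs (m + n) (tensor m n f g)
        \<longleftrightarrow> k \<in> outputs m f \<union> (\<lambda>k. k + m) ` outputs n g"
    proof cases
      case 1
      then show ?thesis using left[of k] by (auto simp: outputs_def)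
    next
      case 2
      then show ?thesis using right[of l] by (auto simp: outputs_def image_iff)
    qed
  qed
qed

text \<open>Induction on the construction. The complement exchanges outputs and inputs, which
  reverses the order, while \<open>1 - f\<close> reverses the values; a permutation transports the
  order; a tensor product multiplies nonnegative monotone functions of the two blocks. Only the
  value of the complement at the zero string needs care.\<close>

lemma is_type_mono:
  assumes "is_type n f" "s \<in> strings n" "t \<in> strings n"
    and "ones s \<inter> outputs n f \<subseteq> ones t" "ones t \<subseteq> ones s \<union> outputs n f"
  shows "f s \<le> f t"
  using assms
proof (induction arbitrary: s t rule: is_type.induct)
  case one
  then show ?case by (simp add: one_def)
next
  case (compl n f)
  note F = is_type_in_F[OF compl.hyps]
  note O = outputs_compl[OF F]
  have le: "f t \<le> f s"
    by (rule compl.IH) (use compl.prems ones_subset[of s n] ones_subset[of t n] O in auto)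
  \<comment> \<open>The correction at the zero string can only hurt when \<open>s\<close> is zero
    and \<open>t\<close> is not. Then all ones of \<open>t\<close> are inputs of \<open>f\<close>,
    so \<open>t\<close> lies below the unit string of any \<open>k\<close> in \<open>ones t\<close>
    in the order of \<open>f\<close>, and \<open>f\<close> vanishes at that unit string.\<close>
  show ?case
  proof (cases "ones s = {} \<and> ones t \<noteq> {}")
    case True
    then obtain k where k: "k \<in> ones t" by auto
    then have kO: "k \<in> {1..n}" "k \<notin> outputs n f" using True compl.prems O by auto
    have "f t \<le> f (unit_string n k)"
    proof (rule compl.IH)
      show "ones t \<inter> outputs n f \<subseteq> ones (unit_string n k)"
        using True compl.prems O by auto
    qed (use k kO compl.prems ones_unit_string in auto)
    moreover have "f (unit_string n k) = 0"
      using kO F_dest(1)[OF F, of "unit_string n k"] by (auto simp: outputs_def)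
    ultimately have "f t = 0" using F_dest(1)[OF F, of t] compl.prems by auto
    moreover have "f s = 1" using True F_dest(2)[OF F] compl.prems ones_empty_iff by auto
    ultimately show ?thesis using True compl.prems by (simp add: compl_def p_zero_eq)
  next
    case False
    have "f s = 1" if "ones s = {}"
      using that F_dest(2)[OF F] compl.prems ones_empty_iff by auto
    moreover have "f t = 1" if "ones t = {}"
      using that F_dest(2)[OF F] compl.prems ones_empty_iff by auto
    ultimately show ?thesis using False le compl.prems F_dest(1)[OF F, of s] 
      by (auto simp: compl_def p_zero_eq)
  qed
next
  case (perm n f \<sigma>)
  note O = outputs_perm_comp[OF perm.hyps(2), of f]
  have "inj \<sigma>" using perm.hyps(2) permutes_inj by blast
  have "f (act n \<sigma> s) \<le> f (act n \<sigma> t)"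
  proof (rule perm.IH)
    show "ones (act n \<sigma> s) \<inter> outputs n f \<subseteq> ones (act n \<sigma> t)"
      using perm.prems image_mono[OF perm.prems(3), of \<sigma>]
      by (simp add: ones_act[OF perm.hyps(2)] flip: O image_Int[OF \<open>inj \<sigma>\<close>])
    show "ones (act n \<sigma> t) \<subseteq> ones (act n \<sigma> s) \<union> outputs n f"
      using perm.prems image_mono[OF perm.prems(4), of \<sigma>]
      by (simp add: ones_act[OF perm.hyps(2)] image_Un flip: O)
  qed (use perm.prems act_in_strings in auto)
  then show ?case using perm.prems by (simp add: perm_comp_def)
next
  case (tensor m f n g)
  note F = tensor.hyps[THEN is_type_in_F]
  note O = outputs_tensor[OF F]
  have td: "take m s \<in> strings m" "take m t \<in> strings m" "drop m s \<in> strings n" "drop m t \<in> strings n"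
    using tensor.prems take_drop_in_strings by blast+
  have "f (take m s) \<le> f (take m t)"
    by (rule tensor.IH(1)) (use td tensor.prems O in \<open>auto simp: ones_take outputs_def\<close>)
  moreover have "g (drop m s) \<le> g (drop m t)"
    \<comment> \<open>The outputs of \<open>f\<close> lie in \<open>{1..m}\<close>, so they do not
      interfere with the shifted second block.\<close>
    by (rule tensor.IH(2)) (use td tensor.prems O outputs_subset[of m f] in \<open>force simp: ones_drop\<close>)+
  moreover have "0 \<le> f (take m t)" "0 \<le> g (drop m s)"
    using F_dest(1)[OF F(1) td(2)] F_dest(1)[OF F(2) td(3)] by auto
  ultimately show ?case using tensor.prems by (simp add: tensor_def mult_mono)
qed

subsection \<open>Type functions on arbitrary index sets\<close>

text \<open>
  Labelling the letters by any finite set \<open>V\<close> instead of \<open>{1..m}\<close> turns the tensor product into a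
  product over a disjoint union; a single permutation is then applied at the end.
\<close>

definition type_on :: "nat set \<Rightarrow> (nat set \<Rightarrow> bool) \<Rightarrow> bool" where
  "type_on V P \<longleftrightarrow> (\<exists>m \<phi> f. bij_betw \<phi> {1..m} V \<and> is_type m f \<and>
     (\<forall>s\<in>strings m. f s = of_bool (P (\<phi> ` ones s))))"

lemma type_on_cong:
  assumes "type_on V P" "\<And>A. A \<subseteq> V \<Longrightarrow> P A \<longleftrightarrow> Q A"
  shows "type_on V Q"
proof -
  obtain m \<phi> f where f: "bij_betw \<phi> {1..m} V" "is_type m f"
      "\<forall>s\<in>strings m. f s = of_bool (P (\<phi> ` ones s))"
    using assms(1) by (auto simp: type_on_def)
  have "\<phi> ` ones s \<subseteq> V" if "s \<in> strings m" for s
    using f(1) ones_subset[OF that] by (auto simp: bij_betw_def)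
  then have "\<forall>s\<in>strings m. f s = of_bool (Q (\<phi> ` ones s))"
    using f(3) assms(2) by simp
  then show ?thesis using f(1,2) unfolding type_on_def by blast
qed

lemma type_on_singleton: "type_on {v} (\<lambda>A. True)"
  unfolding type_on_def
  by (rule exI[of _ 1], rule exI[of _ "\<lambda>_. v"], rule exI[of _ "one 1"])
    (use is_type.one in \<open>auto simp: bij_betw_def one_def\<close>)

text \<open>The disjunct \<open>A = {}\<close> comes from the summand \<open>p_zero\<close>, since
  type functions are 1 at the zero string.\<close>

lemma type_on_compl:
  assumes "type_on V P"
  shows "type_on V (\<lambda>A. A = {} \<or> \<not> P A)"
proof -
  obtain m \<phi> f where f: "bij_betw \<phi> {1..m} V" "is_type m f"
      "\<forall>s\<in>strings m. f s = of_bool (P (\<phi> ` ones s))"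
    using assms by (auto simp: type_on_def)
  have "compl m f s = of_bool (\<phi> ` ones s = {} \<or> \<not> P (\<phi> ` ones s))" if "s \<in> strings m" for s
    using that f(3) F_dest(2)[OF is_type_in_F[OF f(2)]] ones_empty_iff[OF that]
    by (auto simp: compl_def p_zero_eq)
  then show ?thesis using f(1) is_type.compl[OF f(2)] unfolding type_on_def by blast
qed

lemma type_on_tensor:
  assumes "type_on V P" "type_on W Q" "V \<inter> W = {}"
  shows "type_on (V \<union> W) (\<lambda>A. P (A \<inter> V) \<and> Q (A \<inter> W))"
proof -
  obtain m \<phi> f where f: "bij_betw \<phi> {1..m} V" "is_type m f"
      "\<forall>s\<in>strings m. f s = of_bool (P (\<phi> ` ones s))"
    using assms(1) by (auto simp: type_on_def)
  obtain n \<psi> g where g: "bij_betw \<psi> {1..n} W" "is_type n g"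
      "\<forall>s\<in>strings n. g s = of_bool (Q (\<psi> ` ones s))"
    using assms(2) by (auto simp: type_on_def)
  \<comment> \<open>Glues the two labellings: positions up to \<open>m\<close> belong to the first
    factor, the next \<open>n\<close> to the second, shifted by \<open>m\<close>.\<close>
  define \<chi> where "\<chi> k = (if k \<le> m then \<phi> k else \<psi> (k - m))" for k
  have "bij_betw \<chi> {1..m} V"
    using f(1) by (rule bij_betw_cong[THEN iffD1, rotated]) (simp add: \<chi>_def)
  moreover have "bij_betw \<chi> {m + 1..m + n} W"
  proof -
    have "bij_betw (\<lambda>k. k - m) {m + 1..m + n} {1..n}"
      by (rule bij_betw_byWitness[where f' = "\<lambda>k. k + m"]) auto
    from bij_betw_trans[OF this g(1)] show ?thesis
      by (rule bij_betw_cong[THEN iffD1, rotated]) (simp add: \<chi>_def)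
  qed
  moreover have "{1..m} \<union> {m + 1..m + n} = {1..m + n}" by auto
  ultimately have bij: "bij_betw \<chi> {1..m + n} (V \<union> W)"
    using bij_betw_combine[of \<chi> "{1..m}" V "{m + 1..m + n}" W] assms(3) by simp
  have "tensor m n f g s = of_bool (P (\<chi> ` ones s \<inter> V) \<and> Q (\<chi> ` ones s \<inter> W))"
    if s: "s \<in> strings (m + n)" for s
  proof -
    have td: "take m s \<in> strings m" "drop m s \<in> strings n"
      using take_drop_in_strings[OF s] by auto
    have "\<chi> ` ones (take m s) = \<phi> ` ones (take m s)"
      using ones_subset[OF td(1)] by (auto simp: \<chi>_def intro!: image_cong)
    moreover have "(\<lambda>k. \<chi> (k + m)) ` ones (drop m s) = \<psi> ` ones (drop m s)"
      using ones_subset[OF td(2)] by (intro image_cong) (auto simp: \<chi>_def)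
    ultimately have eq: "\<chi> ` ones s = \<phi> ` ones (take m s) \<union> \<psi> ` ones (drop m s)"
      by (simp add: ones_take_drop[OF s] image_Un image_image)
    have "\<phi> ` ones (take m s) \<subseteq> V" "\<psi> ` ones (drop m s) \<subseteq> W"
      using f(1) g(1) ones_subset[OF td(1)] ones_subset[OF td(2)] by (auto simp: bij_betw_def)
    then have "\<chi> ` ones s \<inter> V = \<phi> ` ones (take m s)" "\<chi> ` ones s \<inter> W = \<psi> ` ones (drop m s)"
      using eq assms(3) by auto
    then show ?thesis using f(3) g(3) td s by (simp add: tensor_def)
  qed
  then show ?thesis using bij is_type.tensor[OF f(2) g(2)] unfolding type_on_def by blast
qed

lemma type_on_one:
  assumes "finite V" "V \<noteq> {}"
  shows "type_on V (\<lambda>A. True)"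
  using assms
proof (induction rule: finite_ne_induct)
  case (singleton v)
  show ?case by (rule type_on_singleton)
next
  case (insert v V)
  then show ?case using type_on_tensor[OF type_on_singleton insert.IH, of v] by simp
qed

lemma type_on_extend:
  assumes "type_on V P" "finite W" "V \<inter> W = {}"
  shows "type_on (V \<union> W) (\<lambda>A. P (A \<inter> V))"
proof (cases "W = {}")
  \<comment> \<open>There is no type function on zero letters, so an empty \<open>W\<close> cannot
    be a tensor factor.\<close>
  case True
  then show ?thesis using type_on_cong[OF assms(1)] by (simp add: Int_absorb2)
next
  case False
  then show ?thesis using type_on_tensor[OF assms(1) type_on_one[OF assms(2)]] assms(3) by simp
qed

lemma type_on_imp_is_type:
  assumes "type_on {1..n} P"
  shows "is_type n (chi n P)"
proof -
  obtain m \<phi> f where f: "bij_betw \<phi> {1..m} {1..n}" "is_type m f"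
      "\<forall>s\<in>strings m. f s = of_bool (P (\<phi> ` ones s))"
    using assms by (auto simp: type_on_def)
  have m: "m = n" using bij_betw_same_card[OF f(1)] by simp
  \<comment> \<open>The labelling, extended by the identity because \<open>permutes\<close> demands
    fixed points outside \<open>{1..n}\<close>.\<close>
  define \<sigma> where "\<sigma> k = (if k \<in> {1..n} then \<phi> k else k)" for k
  have "bij_betw \<sigma> {1..n} {1..n}"
    using f(1) unfolding m by (rule bij_betw_cong[THEN iffD1, rotated]) (simp add: \<sigma>_def)
  then have \<sigma>: "\<sigma> permutes {1..n}" by (rule bij_imp_permutes) (simp only: \<sigma>_def if_False)
  \<comment> \<open>The inverse appears because the action moves the ones of \<open>s\<close> by the
    permutation, and the labelling must bring them back.\<close>
  have "perm_comp n f (inv \<sigma>) = chi n P"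
  proof
    fix s
    show "perm_comp n f (inv \<sigma>) s = chi n P s"
    proof (cases "s \<in> strings n")
      case True
      have "inv \<sigma> ` ones s \<subseteq> {1..n}"
        using image_mono[OF ones_subset[OF True], of "inv \<sigma>"] permutes_image[OF permutes_inv[OF \<sigma>]]
        by simp
      then have "\<phi> ` inv \<sigma> ` ones s = \<sigma> ` inv \<sigma> ` ones s"
        unfolding \<sigma>_def by (intro image_cong) auto
      also have "\<dots> = ones s" by (simp add: image_image permutes_inverses[OF \<sigma>])
      finally show ?thesis
        using True f(3) act_in_strings[OF True]
        by (simp add: m perm_comp_def chi_def ones_act[OF permutes_inv[OF \<sigma>]])
    qed (simp add: perm_comp_def chi_def)
  qed
  then show ?thesis using is_type.perm[OF f(2)[unfolded m] permutes_inv[OF \<sigma>]] by simp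
qed

subsection \<open>The generators\<close>

text \<open>This is \<open>p_1\<close>, the complement of the constant on one letter.\<close>

lemma type_on_not_mem: "type_on {v} (\<lambda>A. v \<notin> A)"
  by (rule type_on_cong[OF type_on_compl[OF type_on_singleton]]) auto

text \<open>Complement of \<open>p_1 \<otimes> 1\<close>, with \<open>p_1\<close> on the letter
  \<open>j\<close> and the constant on \<open>V\<close>.\<close>

lemma type_on_mem:
  assumes "finite V" "j \<notin> V"
  shows "type_on (insert j V) (\<lambda>A. A = {} \<or> j \<in> A)"
proof -
  have "type_on ({j} \<union> V) (\<lambda>A. j \<notin> A \<inter> {j})"
    by (rule type_on_extend[OF type_on_not_mem]) (use assms in auto)
  from type_on_compl[OF this] show ?thesis by (simp only: insert_is_Un[of j V]) (erule type_on_cong, auto)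
qed

text \<open>\<open>N = 0\<close>, for the generators whose three-term chain fails to be
  strict.\<close>

lemma chain_typeI_single:
  assumes "f \<in> types n" "S \<subseteq> {1..n}" "f = p n S"
  shows "chain_type n f"
  unfolding chain_type_def
  by (rule conjI[OF assms(1)], rule exI[of _ 0], rule exI[of _ "\<lambda>_. S"])
    (use assms in \<open>auto simp: p_def fun_eq_iff\<close>)

lemma chain_typeI_triple:
  assumes "f \<in> types n" "S \<subset> T" "T \<subset> U" "U \<subseteq> {1..n}"
    and "f = (\<lambda>s\<in>strings n. p n S s - p n T s + p n U s)"
  shows "chain_type n f"
  unfolding chain_type_def
  by (rule conjI[OF assms(1)], rule exI[of _ 2], rule exI[of _ "\<lambda>i. if i = 0 then S else if i = 1 then T else U"])
    (use assms in \<open>auto simp: less_2_cases_iff numeral_2_eq_2\<close>)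

locale input_output_split =
  fixes n :: nat and Out In :: "nat set"
  assumes Out: "Out \<subseteq> {1..n}" and In: "In = {1..n} - Out"
begin

lemma finite_Out: "finite Out" and finite_In: "finite In"
  using Out In finite_subset by auto

text \<open>If \<open>j \<in> A\<close>, both \<open>p\<close> terms vanish; otherwise the first
  cancels the 1 and the second tests whether \<open>A\<close> misses \<open>In\<close>.\<close>

lemma gen_out_eq:
  assumes "j \<in> Out"
  shows "gen_out n In j = chi n (\<lambda>A. A \<inter> In = {} \<or> j \<in> A)"
  using assms Out In unfolding gen_out_def
  by (subst p_eq, force, subst p_eq, force) (auto simp: chi_def fun_eq_iff restrict_def)

text \<open>If \<open>j \<in> A\<close>, only the test \<open>i \<notin> A\<close> survives, and it
  follows from \<open>A \<inter> In = {}\<close> because \<open>i \<in> In\<close>. Otherwise the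
  first two terms cancel.\<close>

lemma gen_in_out_eq:
  assumes "j \<in> Out" "i \<in> In"
  shows "gen_in_out n In i j = chi n (\<lambda>A. A \<inter> In = {} \<or> (j \<in> A \<and> i \<notin> A))"
  using assms Out In unfolding gen_in_out_def
  by (subst p_eq, force, subst p_eq, force, subst p_eq, force) (auto simp: chi_def fun_eq_iff restrict_def)

lemma type_gen_out:
  assumes "j \<in> Out"
  shows "gen_out n In j \<in> types n"
proof -
  \<comment> \<open>The three factors of \<open>(p_1 \<otimes> 1)^* \<otimes> 1\<close> sit on
    \<open>{j}\<close>, \<open>In\<close> and \<open>Out - {j}\<close>.\<close>
  have "type_on (insert j In \<union> (Out - {j})) (\<lambda>A. A \<inter> insert j In = {} \<or> j \<in> A \<inter> insert j In)"
    by (rule type_on_extend[OF type_on_mem[OF finite_In]]) (use assms In finite_Out in auto)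
  moreover have "insert j In \<union> (Out - {j}) = {1..n}" using assms Out In by auto
  ultimately have "type_on {1..n} (\<lambda>A. A \<inter> In = {} \<or> j \<in> A)"
    by (simp) (erule type_on_cong, auto)
  then show ?thesis by (simp add: types_def gen_out_eq assms type_on_imp_is_type)
qed

lemma type_gen_in_out:
  assumes "j \<in> Out" "i \<in> In"
  shows "gen_in_out n In i j \<in> types n"
proof -
  \<comment> \<open>The letter \<open>i\<close> carries the separate factor \<open>p_1\<close>; the
    complemented factor lives on \<open>j\<close> and the other inputs.\<close>
  let ?V = "insert j (In - {i})"
  have "type_on ({i} \<union> ?V) (\<lambda>A. i \<notin> A \<inter> {i} \<and> (A \<inter> ?V = {} \<or> j \<in> A \<inter> ?V))"
    by (rule type_on_tensor[OF type_on_not_mem type_on_mem]) (use assms In finite_In in auto)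
  then have "type_on (({i} \<union> ?V) \<union> (Out - {j}))
      (\<lambda>A. i \<notin> A \<inter> ({i} \<union> ?V) \<inter> {i} \<and> (A \<inter> ({i} \<union> ?V) \<inter> ?V = {} \<or> j \<in> A \<inter> ({i} \<union> ?V) \<inter> ?V))"
    by (rule type_on_extend) (use assms In finite_Out in auto)
  moreover have "({i} \<union> ?V) \<union> (Out - {j}) = {1..n}" using assms Out In by auto
  ultimately have "type_on {1..n}
      (\<lambda>A. i \<notin> A \<inter> ({i} \<union> ?V) \<inter> {i} \<and> (A \<inter> ({i} \<union> ?V) \<inter> ?V = {} \<or> j \<in> A \<inter> ({i} \<union> ?V) \<inter> ?V))"
    by simp
  \<comment> \<open>A set missing \<open>In\<close> misses \<open>i\<close> and either contains
    \<open>j\<close> or misses \<open>?V\<close>; conversely, missing both \<open>i\<close> and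
    \<open>?V\<close> means missing \<open>In\<close>.\<close>
  then have "type_on {1..n} (\<lambda>A. A \<inter> In = {} \<or> (j \<in> A \<and> i \<notin> A))"
    by (rule type_on_cong) (use assms in auto)
  then show ?thesis by (simp add: types_def gen_in_out_eq assms type_on_imp_is_type)
qed

lemma outputs_chi: "outputs n (chi n P) = {k \<in> {1..n}. P {k}}"
  by (auto simp: outputs_def chi_def ones_unit_string)

text \<open>At \<open>{k}\<close> the test \<open>{k} \<inter> In = {}\<close> already selects
  \<open>Out\<close>; the other disjunct can only add \<open>j\<close>, which lies there.\<close>

lemma generators_types_out: "generators n In Out \<subseteq> types_out n Out"
proof
  fix f assume "f \<in> generators n In Out"
  then consider j where "j \<in> Out" "f = gen_out n In j"
    | i j where "j \<in> Out" "i \<in> In" "f = gen_in_out n In i j"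
    by (auto simp: generators_def)
  then show "f \<in> types_out n Out"
  proof cases
    case 1
    have "outputs n f = {k \<in> {1..n}. {k} \<inter> In = {} \<or> j = k}" by (simp add: 1 gen_out_eq outputs_chi)
    also have "\<dots> = Out" using 1(1) Out In by auto
    finally show ?thesis using 1 type_gen_out by (simp add: types_out_def)
  next
    case 2
    have "outputs n f = {k \<in> {1..n}. {k} \<inter> In = {} \<or> j = k \<and> i \<noteq> k}"
      by (simp add: 2 gen_in_out_eq outputs_chi)
    also have "\<dots> = Out" using 2(1,2) Out In by auto
    finally show ?thesis using 2 type_gen_in_out by (simp add: types_out_def)
  qed
qed

lemma generators_chain_type:
  assumes "f \<in> generators n In Out"
  shows "chain_type n f"
proof -
  have type: "f \<in> types n" using assms generators_types_out by (auto simp: types_out_def)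
  consider j where "j \<in> Out" "f = gen_out n In j"
    | i j where "j \<in> Out" "i \<in> In" "f = gen_in_out n In i j"
    using assms by (auto simp: generators_def)
  then show ?thesis
  proof cases
    case 1
    \<comment> \<open>Without inputs, \<open>{j}\<close> and \<open>In \<union> {j}\<close>
      coincide, their terms cancel, and the constant 1 remains.\<close>
    show ?thesis
    proof (cases "In = {}")
      case True
      then have "f = p n {}" using gen_out_eq[OF 1(1)] by (simp add: 1 p_eq)
      then show ?thesis by (intro chain_typeI_single[OF type, of "{}"]) auto
    next
      case False
      show ?thesis by (rule chain_typeI_triple[OF type, of "{}" "{j}" "In \<union> {j}"])
        (use 1 False In Out in \<open>auto simp: gen_out_def p_def\<close>)
    qed
  next
    case 2
    \<comment> \<open>If \<open>i\<close> is the only input, the last two sets of the chain coincide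
      and \<open>p n {i}\<close> remains.\<close>
    show ?thesis
    proof (cases "In = {i}")
      case True
      have "i \<in> {1..n}" using 2 In by auto
      have "f = chi n (\<lambda>A. A \<inter> In = {} \<or> (j \<in> A \<and> i \<notin> A))"
        using gen_in_out_eq[OF 2(1,2)] 2(3) by simp
      also have "\<dots> = p n {i}"
        using \<open>i \<in> {1..n}\<close> by (subst p_eq) (auto simp: True intro!: chi_cong)
      finally show ?thesis
        using \<open>i \<in> {1..n}\<close> by (intro chain_typeI_single[OF type, of "{i}"]) auto
    next
      case False
      show ?thesis by (rule chain_typeI_triple[OF type, of "{i}" "{i, j}" "In \<union> {j}"])
        (use 2 False In Out in \<open>auto simp: gen_in_out_def\<close>)
    qed
  qed
qed

end

subsection \<open>The generated lattice\<close>

lemma sublattice_least: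
  assumes "G \<subseteq> sublattice n H"
  shows "sublattice n G \<subseteq> sublattice n H"
proof
  fix f assume "f \<in> sublattice n G"
  then show "f \<in> sublattice n H"
    by induction (use assms in \<open>auto intro: sublattice.intros\<close>)
qed

lemma join_chi: "join n (chi n P) (chi n Q) = chi n (\<lambda>A. P A \<or> Q A)"
  by (auto simp: join_def chi_def fun_eq_iff restrict_def)

lemma meet_chi: "meet n (chi n P) (chi n Q) = chi n (\<lambda>A. P A \<and> Q A)"
  by (auto simp: meet_def chi_def fun_eq_iff restrict_def)

text \<open>\<open>X\<close> has to be nonempty: an empty join would be the constant 0, which is not
  in \<open>F n\<close>.\<close>

lemma sublattice_Bex:
  assumes "finite X" "X \<noteq> {}" "\<And>x. x \<in> X \<Longrightarrow> chi n (P x) \<in> sublattice n G"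
  shows "chi n (\<lambda>A. \<exists>x\<in>X. P x A) \<in> sublattice n G"
  using assms
proof (induction rule: finite_ne_induct)
  case (insert x X)
  then have "join n (chi n (P x)) (chi n (\<lambda>A. \<exists>x\<in>X. P x A)) \<in> sublattice n G"
    by (intro sublattice.join) auto
  then show ?case by (simp add: join_chi)
qed simp

lemma sublattice_Ball:
  assumes "finite X" "X \<noteq> {}" "\<And>x. x \<in> X \<Longrightarrow> chi n (P x) \<in> sublattice n G"
  shows "chi n (\<lambda>A. \<forall>x\<in>X. P x A) \<in> sublattice n G"
  using assms
proof (induction rule: finite_ne_induct)
  case (insert x X)
  then have "meet n (chi n (P x)) (chi n (\<lambda>A. \<forall>x\<in>X. P x A)) \<in> sublattice n G"
    by (intro sublattice.meet) auto
  then show ?case by (simp add: meet_chi)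
qed simp

context input_output_split
begin

lemma type_mono:
  assumes "f \<in> types_out n Out" "A \<subseteq> {1..n}" "B \<subseteq> {1..n}" "A \<inter> Out \<subseteq> B" "B \<inter> In \<subseteq> A"
    and "f (string_of n A) = 1"
  shows "f (string_of n B) = 1"
proof -
  have f: "is_type n f" "outputs n f = Out" using assms(1) by (auto simp: types_out_def types_def)
  have "f (string_of n A) \<le> f (string_of n B)"
    by (rule is_type_mono[OF f(1)]) (use assms f(2) In in \<open>auto simp: ones_string_of\<close>)
  then show ?thesis
    using assms(6) F_dest(1)[OF is_type_in_F[OF f(1)] string_of_in_strings, of B] by auto
qed

lemma type_empty:
  assumes "f \<in> types_out n Out"
  shows "f (string_of n {}) = 1"
proof -
  have "f \<in> F n" using assms is_type_in_F by (auto simp: types_out_def types_def)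
  moreover have "string_of n {} = zero_string n"
    by (simp add: string_of_def zero_string_def map_replicate_const del: upt_Suc)
  ultimately show ?thesis using F_dest(2) by simp
qed

text \<open>A nonempty set of inputs lies below each \<open>{i}\<close> with \<open>i\<close> in it,
  so by monotonicity value 1 would make \<open>i\<close> an output.\<close>

lemma type_inputs:
  assumes "f \<in> types_out n Out" "A \<subseteq> In" "f (string_of n A) = 1"
  shows "A = {}"
proof (rule ccontr)
  assume "A \<noteq> {}"
  then obtain i where i: "i \<in> A" by auto
  then have "f (string_of n {i}) = 1"
    by (intro type_mono[OF assms(1) _ _ _ _ assms(3)]) (use assms(2) In in auto)
  then have "i \<in> outputs n f" using i assms(2) In by (auto simp: outputs_def unit_string_eq)
  then show False using i assms In by (auto simp: types_out_def)
qed

text \<open>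
  Above \<open>p\<^sub>I\<close>, the principal up-set of \<open>A\<close> in the order of \<open>type_mono\<close> is a meet of generators as
  soon as \<open>A\<close> meets \<open>O\<close>.
\<close>

lemma principal_in_sublattice:
  assumes "A \<inter> Out \<noteq> {}"
  shows "chi n (\<lambda>B. B \<inter> In = {} \<or> (A \<inter> Out \<subseteq> B \<and> B \<inter> In \<subseteq> A)) \<in> sublattice n (generators n In Out)"
proof -
  let ?C = "\<lambda>j B. B \<inter> In = {} \<or> j \<in> B"
  let ?D = "\<lambda>j i B. B \<inter> In = {} \<or> (j \<in> B \<and> i \<notin> B)"
  have C: "chi n (?C j) \<in> sublattice n (generators n In Out)" if "j \<in> Out" for j
    using that by (intro sublattice.gen) (auto simp: generators_def simp flip: gen_out_eq)
  have D: "chi n (?D j i) \<in> sublattice n (generators n In Out)" if "j \<in> Out" "i \<in> In" for i j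
    using that by (intro sublattice.gen) (auto simp: generators_def simp flip: gen_in_out_eq)
  \<comment> \<open>\<open>?C j\<close> follows from each \<open>?D j i\<close>; it supplies a
    factor when \<open>A\<close> contains all inputs and there is no \<open>i\<close> to
    exclude.\<close>
  have "chi n (\<lambda>B. ?C j B \<and> (\<forall>i\<in>In - A. ?D j i B)) \<in> sublattice n (generators n In Out)"
    if j: "j \<in> Out" for j
  proof (cases "In - A = {}")
    case True
    then show ?thesis using C[OF j] by (simp only: True) simp
  next
    case False
    have "chi n (\<lambda>B. \<forall>i\<in>In - A. ?D j i B) \<in> sublattice n (generators n In Out)"
      by (rule sublattice_Ball) (use False finite_In D[OF j] in auto)
    from sublattice.meet[OF C[OF j] this] show ?thesis by (simp add: meet_chi)
  qed
  then have "chi n (\<lambda>B. \<forall>j\<in>A \<inter> Out. ?C j B \<and> (\<forall>i\<in>In - A. ?D j i B)) \<in> sublattice n (generators n In Out)"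
    using assms finite_Out by (intro sublattice_Ball) auto
  \<comment> \<open>The condition on the inputs is repeated for each \<open>j\<close>, so a single
    \<open>j\<close> in \<open>A \<inter> Out\<close> enforces
    \<open>B \<inter> In \<subseteq> A\<close>.\<close>
  also have "(\<lambda>B. \<forall>j\<in>A \<inter> Out. ?C j B \<and> (\<forall>i\<in>In - A. ?D j i B))
      = (\<lambda>B. B \<inter> In = {} \<or> (A \<inter> Out \<subseteq> B \<and> B \<inter> In \<subseteq> A))"
    using assms by (intro ext) blast
  finally show ?thesis .
qed

lemma types_out_subset_sublattice:
  assumes "Out \<noteq> {}"
  shows "types_out n Out \<subseteq> sublattice n (generators n In Out)"
proof
  fix f assume f: "f \<in> types_out n Out"
  \<comment> \<open>The generators of the up-sets to be joined; they must meet \<open>Out\<close>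
    for \<open>principal_in_sublattice\<close> to apply. The set \<open>{j}\<close> is one of them,
    as it lies above \<open>{}\<close>.\<close>
  define X where "X = {A. A \<subseteq> {1..n} \<and> A \<inter> Out \<noteq> {} \<and> f (string_of n A) = 1}"
  obtain j where j: "j \<in> Out" using assms by auto
  have "f (string_of n {j}) = 1"
    using type_mono[OF f _ _ _ _ type_empty[OF f]] j Out In by auto
  then have "{j} \<in> X" using j Out by (auto simp: X_def)
  then have "X \<noteq> {}" by auto
  moreover have "finite X"
    by (rule finite_subset[of _ "Pow {1..n}"]) (auto simp: X_def)
  ultimately have "chi n (\<lambda>B. \<exists>A\<in>X. B \<inter> In = {} \<or> (A \<inter> Out \<subseteq> B \<and> B \<inter> In \<subseteq> A))
      \<in> sublattice n (generators n In Out)"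
    by (intro sublattice_Bex principal_in_sublattice) (auto simp: X_def)
  also have "chi n (\<lambda>B. \<exists>A\<in>X. B \<inter> In = {} \<or> (A \<inter> Out \<subseteq> B \<and> B \<inter> In \<subseteq> A))
      = chi n (\<lambda>B. f (string_of n B) = 1)"
  proof (rule chi_cong)
    fix B assume B: "B \<subseteq> {1..n}"
    show "(\<exists>A\<in>X. B \<inter> In = {} \<or> (A \<inter> Out \<subseteq> B \<and> B \<inter> In \<subseteq> A)) \<longleftrightarrow> f (string_of n B) = 1"
    proof
      assume "\<exists>A\<in>X. B \<inter> In = {} \<or> (A \<inter> Out \<subseteq> B \<and> B \<inter> In \<subseteq> A)"
      then obtain A where A: "A \<in> X" "B \<inter> In = {} \<or> (A \<inter> Out \<subseteq> B \<and> B \<inter> In \<subseteq> A)" by blast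
      show "f (string_of n B) = 1"
      proof (cases "B \<inter> In = {}")
        case True
        \<comment> \<open>A set without inputs lies above \<open>{}\<close>, where \<open>f\<close>
          is 1.\<close>
        then show ?thesis using type_mono[OF f _ B _ _ type_empty[OF f]] by auto
      next
        case False
        then show ?thesis using A type_mono[OF f _ B] by (auto simp: X_def)
      qed
    next
      assume fB: "f (string_of n B) = 1"
      show "\<exists>A\<in>X. B \<inter> In = {} \<or> (A \<inter> Out \<subseteq> B \<and> B \<inter> In \<subseteq> A)"
      proof (cases "B \<inter> Out = {}")
        case True
        \<comment> \<open>The only set of value 1 outside \<open>X\<close> is empty, and it
          satisfies the first disjunct for every \<open>A\<close> in \<open>X\<close>.\<close>
        then have "B = {}" using type_inputs[OF f _ fB] B In by auto
        then show ?thesis using \<open>X \<noteq> {}\<close> by auto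
      next
        case False
        then show ?thesis using B fB by (auto simp: X_def)
      qed
    qed
  qed
  also have "\<dots> = f"
    using f is_type_in_F by (intro F_eq_chi[symmetric]) (auto simp: types_out_def types_def)
  finally show "f \<in> sublattice n (generators n In Out)" .
qed

text \<open>For \<open>Out = {}\<close> there are no generators and their sublattice is empty, which
  is why that case is treated separately.\<close>

lemma R_eq_sublattice:
  assumes "Out \<noteq> {}"
  shows "R n Out = sublattice n (generators n In Out)"
  unfolding R_def
proof
  show "sublattice n (types_out n Out) \<subseteq> sublattice n (generators n In Out)"
    by (rule sublattice_least[OF types_out_subset_sublattice[OF assms]])
  show "sublattice n (generators n In Out) \<subseteq> sublattice n (types_out n Out)"
    using generators_types_out by (intro sublattice_least) (auto intro: sublattice.gen)
qed

text \<open>All indices are inputs, so \<open>type_inputs\<close> leaves the zero string as the only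
  place of value 1.\<close>

lemma types_out_empty:
  assumes "Out = {}" "n \<ge> 1"
  shows "types_out n Out = {p_zero n}"
proof -
  have p: "p_zero n = chi n (\<lambda>A. A = {})"
    unfolding p_zero_def chi_def by (rule restrict_ext) (simp add: ones_empty_iff)
  have "f = p_zero n" if f: "f \<in> types_out n Out" for f
  proof -
    have "f = chi n (\<lambda>A. f (string_of n A) = 1)"
      using f is_type_in_F by (intro F_eq_chi) (auto simp: types_out_def types_def)
    also have "\<dots> = chi n (\<lambda>A. A = {})"
      by (rule chi_cong) (use type_inputs[OF f] type_empty[OF f] assms In in auto)
    finally show ?thesis by (simp add: p)
  qed
  \<comment> \<open>\<open>p_n\<close> is the complement of \<open>1_n\<close>;
    \<open>n \<ge> 1\<close> makes the index set nonempty.\<close>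
  moreover have "type_on {1..n} (\<lambda>A. A = {} \<or> \<not> True)"
    by (rule type_on_compl[OF type_on_one]) (use assms in auto)
  then have "is_type n (p_zero n)" using type_on_imp_is_type by (simp add: p)
  then have "p_zero n \<in> types_out n Out" using assms by (simp add: types_out_def types_def p outputs_chi)
  ultimately show ?thesis by blast
qed

lemma R_empty:
  assumes "Out = {}" "n \<ge> 1"
  shows "R n Out = {p_zero n}"
proof -
  have idem: "join n (p_zero n) (p_zero n) = p_zero n" "meet n (p_zero n) (p_zero n) = p_zero n"
    by (auto simp: join_def meet_def p_zero_def fun_eq_iff restrict_def)
  have "f = p_zero n" if "f \<in> sublattice n {p_zero n}" for f
    using that by induction (auto simp: idem)
  then show ?thesis unfolding R_def types_out_empty[OF assms] by (auto intro: sublattice.gen)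
qed

end

theorem corollary4p8:
  fixes n :: nat and Out In :: "nat set"
  assumes "n \<ge> 1" and "Out \<subseteq> {1..n}" and "In = {1..n} - Out"
  shows "(\<forall>f \<in> generators n In Out. chain_type n f \<and> f \<in> types_out n Out) \<and>
         (Out \<noteq> {} \<longrightarrow> R n Out = sublattice n (generators n In Out)) \<and>
         (Out = {} \<longrightarrow> R n Out = {p_zero n})"
proof -
  interpret input_output_split n Out In by standard (use assms in auto)
  show ?thesis
    using generators_chain_type generators_types_out R_eq_sublattice R_empty assms(1) by blast
qed

end
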